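(* Let $\mathcal H$ be a real Hilbert space, $C\subseteq\mathcal H$ nonempty, closed and convex, and $F:\mathcal H\to\mathcal H$. Assume that $SOL(C,F)\neq\emptyset$, that $F$ is monotone on $\mathcal H$, and that $F$ is Lipschitz continuous on $\mathcal H$ with some constant $L>0$. Let the perturbation vectors satisfy $\sum_{k=0}^\infty\|e_i^k\|<+\infty$ for $i=1,2$, and $\|e_1^k\|\le\mu\|x^k-y^k\|$ for all $k\ge0$, where $\mu\in[0,1-\nu)$. Let $\{x^k\}_{k=0}^\infty$ and $\{y^k\}_{k=0}^\infty$ be any sequences generated by the PC-algorithm II with outer perturbations (described in the context). For any integer $t>0$ put $$\Upsilon_t=\sum_{k=0}^t\rho_k\beta_k,\qquad y_t=\frac1{\Upsilon_t}\sum_{k=0}^t\rho_k\beta_ky^k,$$ and, for $x\in C$, $M=M(x)=\sup_{k\in\mathbb N}\{\|x^{k+1}-x\|\}\,\sum_{k=0}^\infty\|e_2^k\|$. Then $y_t\in C$ and $$\langle F(x),y_t-x\rangle\le\frac1{2\gamma\Upsilon_t}\left(\|x-x^0\|^2+2M\right),\qquad\forall x\in C.$$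
   Context: The variational inequality problem is: find $x^*\in C$ with $\langle F(x^* ),x-x^*\rangle\ge 0$ for all $x\in C$; its solution set is $SOL(C,F)$. Monotone means $\langle F(x)-F(y),x-y\rangle\ge0$ for all $x,y\in\mathcal H$. $P_C$ denotes the metric projection onto $C$. $\mathbb N$ includes $0$. PC-algorithm II with outer perturbations: fix $\nu\in(0,1)$ and $\gamma\in(0,2)$. Choose $x^0\in\mathcal H$ arbitrarily. Given $x^k\in\mathcal H$ and perturbation vectors $e_1^k=e_1(x^k)$, $e_2^k=e_2(x^k)$ in $\mathcal H$, set $$y^k=P_C(x^k-\beta_kF(x^k)+e_1^k),$$ where $\beta_k>0$ is selected such that $\beta_k\|F(x^k)-F(y^k)\|\le\nu\|x^k-y^k\|$. Define $$d(x^k,y^k)=(x^k-y^k)-\beta_k(F(x^k)-F(y^k))+e_1^k,\qquad \rho_k=\frac{\langle x^k-y^k,d(x^k,y^k)\rangle}{\|d(x^k,y^k)\|^2},$$ $$x^{k+1}=P_C(x^k-\gamma\rho_k\beta_kF(y^k)+e_2^k).$$ It is understood that $d(x^k,y^k)\ne0$ for all $k$, so that $\rho_k$ is defined. *)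

theory Defs
  imports "HOL-Analysis.Analysis"
begin

text \<open>
  A real Hilbert space is a type of class \<open>{real_inner, complete_space}\<close>.
  The library's \<^const>\<open>closest_point\<close> is restricted to class \<open>heine_borel\<close>, that is, to finite
  dimension, so the metric projection is defined here.
  For nonempty closed convex \<open>C\<close> in a Hilbert space the minimizer exists and is unique.
\<close>

definition metric_proj :: "'a::{real_inner, complete_space} set \<Rightarrow> 'a \<Rightarrow> 'a" where
  "metric_proj C x = (THE p. p \<in> C \<and> (\<forall>q\<in>C. dist x p \<le> dist x q))"

definition SOL :: "'a::real_inner set \<Rightarrow> ('a \<Rightarrow> 'a) \<Rightarrow> 'a set" where
  "SOL C F = {u \<in> C. \<forall>x\<in>C. 0 \<le> F u \<bullet> (x - u)}"

definition monotone_operator :: "('a::real_inner \<Rightarrow> 'a) \<Rightarrow> bool" where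
  "monotone_operator F \<longleftrightarrow> (\<forall>x y. 0 \<le> (F x - F y) \<bullet> (x - y))"

text \<open>In the next two definitions \<open>b\<close> is the step size and \<open>e\<close> the perturbation inside the
  first projection.\<close>

definition pc_direction :: "('a::real_inner \<Rightarrow> 'a) \<Rightarrow> real \<Rightarrow> 'a \<Rightarrow> 'a \<Rightarrow> 'a \<Rightarrow> 'a" where
  "pc_direction F b e x y = (x - y) - b *\<^sub>R (F x - F y) + e"

definition pc_rho :: "('a::real_inner \<Rightarrow> 'a) \<Rightarrow> real \<Rightarrow> 'a \<Rightarrow> 'a \<Rightarrow> 'a \<Rightarrow> real" where
  "pc_rho F b e x y =
     ((x - y) \<bullet> pc_direction F b e x y) / (norm (pc_direction F b e x y))\<^sup>2"

text \<open>
  \<open>pc2_outer C F \<nu> \<gamma> e1 e2 \<beta> x y\<close>: the sequences \<open>x\<close>, \<open>y\<close> are generated by the PC-algorithm II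
  with outer perturbations \<open>e1\<close>, \<open>e2\<close> and step sizes \<open>\<beta>\<close>.  The starting point \<open>x 0\<close> is arbitrary,
  and the algorithm presupposes a nonzero direction at every step.
\<close>

definition pc2_outer ::
  "'a::{real_inner, complete_space} set \<Rightarrow> ('a \<Rightarrow> 'a) \<Rightarrow> real \<Rightarrow> real \<Rightarrow>
   (nat \<Rightarrow> 'a) \<Rightarrow> (nat \<Rightarrow> 'a) \<Rightarrow> (nat \<Rightarrow> real) \<Rightarrow> (nat \<Rightarrow> 'a) \<Rightarrow> (nat \<Rightarrow> 'a) \<Rightarrow> bool" where
  "pc2_outer C F \<nu> \<gamma> e1 e2 \<beta> x y \<longleftrightarrow>
     (\<forall>k. \<beta> k > 0 \<and>
          y k = metric_proj C (x k - \<beta> k *\<^sub>R F (x k) + e1 k) \<and>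
          \<beta> k * norm (F (x k) - F (y k)) \<le> \<nu> * norm (x k - y k) \<and>
          pc_direction F (\<beta> k) (e1 k) (x k) (y k) \<noteq> 0 \<and>
          x (Suc k) = metric_proj C
            (x k - (\<gamma> * pc_rho F (\<beta> k) (e1 k) (x k) (y k) * \<beta> k) *\<^sub>R F (y k) + e2 k))"

end

theory Submission
  imports Defs
begin

text \<open>
  Put \<open>d\<^sub>k = pc_direction F (\<beta> k) (e1 k) (x k) (y k)\<close>.  Everything rests on an estimate for a single
  step: for every \<open>u\<close> in \<open>C\<close>,
    \<open>\<parallel>x\<^sub>k\<^sub>+\<^sub>1 - u\<parallel>\<^sup>2 + 2 \<gamma> \<rho>\<^sub>k \<beta>\<^sub>k \<langle>F y\<^sub>k, y\<^sub>k - u\<rangle> \<le> \<parallel>x\<^sub>k - u\<parallel>\<^sup>2 + 2 \<langle>e2\<^sub>k, x\<^sub>k\<^sub>+\<^sub>1 - u\<rangle>\<close>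
  (lemma \<open>pc_step_estimate\<close>).  It combines the variational inequalities of the two projections.  The
  one for \<open>x\<^sub>k\<^sub>+\<^sub>1\<close> is tested with \<open>u\<close>.  The one for \<open>y\<^sub>k\<close> is tested with \<open>x\<^sub>k\<^sub>+\<^sub>1\<close>, and says that
  \<open>\<langle>\<beta>\<^sub>k F y\<^sub>k, x\<^sub>k\<^sub>+\<^sub>1 - y\<^sub>k\<rangle>\<close> is bounded below by \<open>\<langle>d\<^sub>k, x\<^sub>k\<^sub>+\<^sub>1 - y\<^sub>k\<rangle>\<close>.  The choice of
  \<open>\<rho>\<^sub>k\<close> then makes the remaining quadratic terms equal to \<open>-\<gamma> (2 - \<gamma>) \<rho>\<^sub>k\<^sup>2 \<parallel>d\<^sub>k\<parallel>\<^sup>2\<close> up to a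
  nonpositive square.

  By monotonicity \<open>F y\<^sub>k\<close> may be replaced by \<open>F u\<close> in this estimate, and its sum over \<open>k \<le> t\<close>
  telescopes: what remains is \<open>2 \<gamma> \<Upsilon>\<^sub>t \<langle>F u, y\<^sub>t - u\<rangle> \<le> \<parallel>x\<^sub>0 - u\<parallel>\<^sup>2 + 2 \<Sum>\<^sub>k \<parallel>e2\<^sub>k\<parallel> \<parallel>x\<^sub>k\<^sub>+\<^sub>1 - u\<parallel>\<close>.

  Two points need separate care.  The weights \<open>\<rho>\<^sub>k \<beta>\<^sub>k\<close> are positive (\<open>pc_rho_pos\<close>), so that \<open>y\<^sub>t\<close> is
  a convex combination of points of \<open>C\<close>; this is where \<open>\<mu> + \<nu> < 1\<close> enters.  And the supremum in
  \<open>M\<close> bounds the terms it is taken over only if the iterates are bounded.  This is what a solution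
  \<open>u\<close> of the variational inequality is for: with it the estimate makes \<open>\<parallel>x\<^sub>k - u\<parallel>\<close> quasi-Fejer
  monotone with the summable errors \<open>2 \<parallel>e2\<^sub>k\<parallel>\<close>.
\<close>

section \<open>The metric projection in a Hilbert space\<close>

text \<open>
  The approximate minimizers \<open>p\<close> and \<open>q\<close> are close to each other because their midpoint, which is
  again in \<open>C\<close>, has distance at least \<open>D\<close> from \<open>x\<close>: apply the parallelogram law.
\<close>

lemma parallelogram_near_minimizers:
  fixes x p q :: "'a::real_inner"
  assumes "convex C" "p \<in> C" "q \<in> C"
    and D: "0 \<le> D" "\<And>z. z \<in> C \<Longrightarrow> D \<le> dist x z"
    and p: "(dist x p)\<^sup>2 \<le> D\<^sup>2 + a" and q: "(dist x q)\<^sup>2 \<le> D\<^sup>2 + b"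
  shows "(norm (p - q))\<^sup>2 \<le> 2 * a + 2 * b"
proof -
  let ?m = "(1/2) *\<^sub>R p + (1/2) *\<^sub>R q"
  have "?m \<in> C"
    using assms(1-3) by (intro convexD) auto
  then have "D\<^sup>2 \<le> (dist x ?m)\<^sup>2"
    using D by (intro power_mono) auto
  moreover have "(norm (p - q))\<^sup>2 = 2 * (dist x p)\<^sup>2 + 2 * (dist x q)\<^sup>2 - 4 * (dist x ?m)\<^sup>2"
    by (simp add: dist_norm power2_norm_eq_inner inner_diff_left inner_diff_right
        inner_add_left inner_add_right inner_commute algebra_simps)
  ultimately show ?thesis
    using p q by linarith
qed

lemma closest_point_exists_hilbert:
  fixes C :: "'a::{real_inner, complete_space} set"
  assumes "C \<noteq> {}" "closed C" "convex C"
  obtains p where "p \<in> C" "\<forall>q\<in>C. dist x p \<le> dist x q"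
proof -
  define D where "D = infdist x C"
  have D0: "0 \<le> D"
    by (simp add: D_def infdist_nonneg)
  have D_le: "D \<le> dist x z" if "z \<in> C" for z
    using that by (simp add: D_def infdist_le)
  have "\<exists>p\<in>C. (dist x p)\<^sup>2 \<le> D\<^sup>2 + 1 / real (Suc n)" for n
  proof -
    have "D < sqrt (D\<^sup>2 + 1 / real (Suc n))"
      using D0 by (intro real_less_rsqrt) simp
    then have "(INF a\<in>C. dist x a) < sqrt (D\<^sup>2 + 1 / real (Suc n))"
      using \<open>C \<noteq> {}\<close> by (simp add: D_def infdist_def)
    then obtain p where "p \<in> C" "dist x p < sqrt (D\<^sup>2 + 1 / real (Suc n))"
      using \<open>C \<noteq> {}\<close> by (subst (asm) cInf_less_iff) auto
    then show ?thesis
      using power_mono[of "dist x p" "sqrt (D\<^sup>2 + 1 / real (Suc n))" 2] by auto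
  qed
  then obtain X where X: "\<And>n. X n \<in> C" "\<And>n. (dist x (X n))\<^sup>2 \<le> D\<^sup>2 + 1 / real (Suc n)"
    by metis
  have "Cauchy X"
  proof (rule CauchyI)
    fix e :: real
    assume "0 < e"
    then have "0 < e\<^sup>2 / 4"
      by simp
    then obtain N where N: "1 / real (Suc N) < e\<^sup>2 / 4"
      by (metis nat_approx_posE)
    have "norm (X m - X n) < e" if "N \<le> m" "N \<le> n" for m n
    proof -
      have le: "1 / real (Suc k) \<le> 1 / real (Suc N)" if "N \<le> k" for k
        using that by (simp add: frac_le)
      have "(norm (X m - X n))\<^sup>2 \<le> 2 * (1 / real (Suc m)) + 2 * (1 / real (Suc n))"
        by (rule parallelogram_near_minimizers[OF \<open>convex C\<close> X(1) X(1) D0 D_le X(2) X(2)])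
      then have "(norm (X m - X n))\<^sup>2 < e\<^sup>2"
        using le[OF that(1)] le[OF that(2)] N by linarith
      then show ?thesis
        using \<open>0 < e\<close> by (simp add: power_less_imp_less_base)
    qed
    then show "\<exists>N. \<forall>m\<ge>N. \<forall>n\<ge>N. norm (X m - X n) < e"
      by blast
  qed
  then obtain p where p: "X \<longlonglongrightarrow> p"
    using Cauchy_convergent convergent_def by blast
  have "p \<in> C"
    using \<open>closed C\<close> X(1) p by (rule closed_sequentially)
  have "(dist x p)\<^sup>2 \<le> D\<^sup>2 + 0"
  proof (rule LIMSEQ_le)
    show "(\<lambda>n. (dist x (X n))\<^sup>2) \<longlonglongrightarrow> (dist x p)\<^sup>2"
      by (intro tendsto_intros p)
    show "(\<lambda>n. D\<^sup>2 + 1 / real (Suc n)) \<longlonglongrightarrow> D\<^sup>2 + 0"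
      using LIMSEQ_inverse_real_of_nat by (intro tendsto_intros) (simp add: inverse_eq_divide)
  qed (use X(2) in blast)
  then have "dist x p \<le> D"
    using D0 power2_le_imp_le[of "dist x p" D] by simp
  then have "\<forall>q\<in>C. dist x p \<le> dist x q"
    using D_le order_trans by blast
  with \<open>p \<in> C\<close> show thesis
    by (rule that)
qed

lemma
  fixes C :: "'a::{real_inner, complete_space} set"
  assumes "C \<noteq> {}" "closed C" "convex C"
  shows metric_proj_in: "metric_proj C z \<in> C"
    and metric_proj_dot: "u \<in> C \<Longrightarrow> (z - metric_proj C z) \<bullet> (u - metric_proj C z) \<le> 0"
proof -
  let ?P = "\<lambda>p. p \<in> C \<and> (\<forall>q\<in>C. dist z p \<le> dist z q)"
  have "\<exists>!p. ?P p"
    using closest_point_exists_hilbert[OF assms, of z] any_closest_point_unique[OF assms(3,2)]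
    by metis
  then have P: "?P (metric_proj C z)"
    unfolding metric_proj_def by (rule theI')
  then show "metric_proj C z \<in> C"
    by blast
  show "(z - metric_proj C z) \<bullet> (u - metric_proj C z) \<le> 0" if "u \<in> C"
    using any_closest_point_dot[OF assms(3,2)] P that by blast
qed

section \<open>One step of the algorithm\<close>

text \<open>
  The lower bound \<open>\<langle>x - y, d\<rangle> \<ge> (1 - \<nu> - \<mu>) \<parallel>x - y\<parallel>\<^sup>2\<close> settles the case \<open>x \<noteq> y\<close>, and \<open>x = y\<close> is
  impossible because it would force \<open>e = 0\<close> and hence \<open>d = 0\<close>.
\<close>

lemma pc_rho_pos:
  assumes b: "0 < b" "b * norm (F x - F y) \<le> \<nu> * norm (x - y)"
    and e: "norm e \<le> \<mu> * norm (x - y)" and "\<mu> < 1 - \<nu>"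
    and d: "pc_direction F b e x y \<noteq> 0"
  shows "0 < pc_rho F b e x y"
proof -
  have "x \<noteq> y"
    using d e by (auto simp: pc_direction_def)
  define n where "n = norm (x - y)"
  have "n > 0"
    using \<open>x \<noteq> y\<close> by (simp add: n_def)
  have "(x - y) \<bullet> (b *\<^sub>R (F x - F y)) \<le> n * (b * norm (F x - F y))"
    using norm_cauchy_schwarz[of "x - y" "b *\<^sub>R (F x - F y)"] b(1) by (simp add: n_def)
  also have "\<dots> \<le> n * (\<nu> * n)"
    using b(2) \<open>n > 0\<close> by (simp add: n_def)
  finally have 1: "(x - y) \<bullet> (b *\<^sub>R (F x - F y)) \<le> \<nu> * n\<^sup>2"
    by (simp add: power2_eq_square algebra_simps)
  have "- ((x - y) \<bullet> e) \<le> n * norm e"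
    using norm_cauchy_schwarz[of "x - y" "- e"] by (simp add: n_def)
  also have "\<dots> \<le> n * (\<mu> * n)"
    using e \<open>n > 0\<close> by (simp add: n_def)
  finally have 2: "- ((x - y) \<bullet> e) \<le> \<mu> * n\<^sup>2"
    by (simp add: power2_eq_square algebra_simps)
  have "0 < (1 - \<nu> - \<mu>) * n\<^sup>2"
    using \<open>n > 0\<close> \<open>\<mu> < 1 - \<nu>\<close> by simp
  also have "\<dots> \<le> n\<^sup>2 - (x - y) \<bullet> (b *\<^sub>R (F x - F y)) + (x - y) \<bullet> e"
    using 1 2 by (simp add: left_diff_distrib)
  also have "\<dots> = (x - y) \<bullet> pc_direction F b e x y"
    unfolding pc_direction_def n_def power2_norm_eq_inner
    by (simp only: inner_add_right inner_diff_right[of "x - y" "x - y"])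
  finally show ?thesis
    using d by (simp add: pc_rho_def)
qed

text \<open>
  The projections enter only through their variational inequalities \<open>first\<close> and \<open>second\<close>, and the
  operator only through its values \<open>f\<close> at \<open>x\<close> and \<open>g\<close> at \<open>y\<close>, so this is plain inner product algebra.
  The new iterate is \<open>p\<close>, and \<open>e\<close>, \<open>h\<close> are the two perturbations.  The inequality that is left
  after the variational inequalities have been added is
    \<open>0 \<le> \<parallel>x - p - \<gamma> r d\<parallel>\<^sup>2 + \<gamma> (2 - \<gamma>) r\<^sup>2 \<parallel>d\<parallel>\<^sup>2\<close>.
\<close>

lemma pc_step_estimate:
  fixes x y p u d e f g h :: "'a::real_inner"
  assumes d: "d = (x - y) - b *\<^sub>R (f - g) + e"
    and r: "0 \<le> r" "r * (norm d)\<^sup>2 = (x - y) \<bullet> d"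
    and \<gamma>: "0 \<le> \<gamma>" "\<gamma> \<le> 2"
    and first: "(x - b *\<^sub>R f + e - y) \<bullet> (p - y) \<le> 0"
    and second: "(x - (\<gamma> * r * b) *\<^sub>R g + h - p) \<bullet> (u - p) \<le> 0"
  shows "(norm (p - u))\<^sup>2 + 2 * \<gamma> * (r * b) * (g \<bullet> (y - u))
           \<le> (norm (x - u))\<^sup>2 + 2 * (h \<bullet> (p - u))"
proof -
  \<comment> \<open>The argument of the first projection, taken relative to \<open>y\<close>, is \<open>d - b g\<close>.\<close>
  have "d \<bullet> (p - y) \<le> b * (g \<bullet> (p - y))"
  proof -
    have "x - b *\<^sub>R f + e - y = d - b *\<^sub>R g"
      by (simp add: d algebra_simps)
    then show ?thesis
      using first by (simp add: inner_diff_left)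
  qed
  then have A: "\<gamma> * r * (d \<bullet> (p - y)) \<le> \<gamma> * r * (b * (g \<bullet> (p - y)))"
    using r(1) \<gamma>(1) by (intro mult_left_mono) auto
  have B: "(x - p) \<bullet> (p - u) \<ge> \<gamma> * r * b * (g \<bullet> (p - u)) - h \<bullet> (p - u)"
  proof -
    have "(x - (\<gamma> * r * b) *\<^sub>R g + h - p) \<bullet> (u - p)
        = - ((x - p) \<bullet> (p - u)) + \<gamma> * r * b * (g \<bullet> (p - u)) - h \<bullet> (p - u)"
      by (simp add: inner_diff_left inner_diff_right inner_add_left algebra_simps)
    then show ?thesis
      using second by linarith
  qed
  have C: "(norm (x - u))\<^sup>2 = (norm (p - u))\<^sup>2 + (norm (x - p))\<^sup>2 + 2 * ((x - p) \<bullet> (p - u))"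
    by (simp add: power2_norm_eq_inner inner_diff_left inner_diff_right inner_commute algebra_simps)
  \<comment> \<open>Completing the square in \<open>x - p\<close>; the cross term comes from \<open>p - y = (x - y) - (x - p)\<close>.\<close>
  have E: "(norm (x - p))\<^sup>2 + \<gamma>\<^sup>2 * r * (r * (norm d)\<^sup>2) \<ge> 2 * (\<gamma> * r) * (d \<bullet> (x - p))"
  proof -
    have "0 \<le> (norm (x - p - (\<gamma> * r) *\<^sub>R d))\<^sup>2"
      by simp
    also have "\<dots> = (norm (x - p))\<^sup>2 + \<gamma>\<^sup>2 * r * (r * (norm d)\<^sup>2) - 2 * (\<gamma> * r) * (d \<bullet> (x - p))"
      unfolding power2_norm_eq_inner
      by (simp add: inner_diff_left inner_diff_right inner_commute power2_eq_square algebra_simps)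
    finally show ?thesis
      by linarith
  qed
  have "d \<bullet> (p - y) = r * (norm d)\<^sup>2 - d \<bullet> (x - p)"
    by (simp add: r(2) inner_diff_left inner_diff_right inner_commute)
  then have F: "\<gamma> * r * (d \<bullet> (p - y)) = \<gamma> * r * (r * (norm d)\<^sup>2) - \<gamma> * r * (d \<bullet> (x - p))"
    by (simp add: right_diff_distrib)
  have G: "0 \<le> 2 * (\<gamma> * r * (r * (norm d)\<^sup>2)) - \<gamma>\<^sup>2 * r * (r * (norm d)\<^sup>2)"
  proof -
    have "0 \<le> \<gamma> * (2 - \<gamma>) * (r\<^sup>2 * (norm d)\<^sup>2)"
      using \<gamma> by simp
    then show ?thesis
      by (simp add: power2_eq_square algebra_simps)
  qed
  have H: "\<gamma> * r * b * (g \<bullet> (p - u)) = \<gamma> * r * (b * (g \<bullet> (p - y))) + \<gamma> * (r * b) * (g \<bullet> (y - u))"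
    by (simp add: inner_diff_right algebra_simps)
  show ?thesis
    using A B C E F G H by linarith
qed

section \<open>Boundedness of the iterates\<close>

text \<open>
  A quasi-Fejer sequence.  The hypothesis gives \<open>a\<^sub>k\<^sub>+\<^sub>1 \<le> a\<^sub>k + 2 \<epsilon>\<^sub>k\<close>: otherwise
  \<open>a\<^sub>k\<^sub>+\<^sub>1\<^sup>2 - a\<^sub>k\<^sup>2 \<ge> (a\<^sub>k\<^sub>+\<^sub>1 - a\<^sub>k) a\<^sub>k\<^sub>+\<^sub>1\<close> would exceed \<open>2 \<epsilon>\<^sub>k a\<^sub>k\<^sub>+\<^sub>1\<close>.
\<close>

lemma quasi_fejer_bounded:
  fixes a \<epsilon> :: "nat \<Rightarrow> real"
  assumes a: "\<And>k. 0 \<le> a k" and \<epsilon>: "\<And>k. 0 \<le> \<epsilon> k" "summable \<epsilon>"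
    and step: "\<And>k. (a (Suc k))\<^sup>2 \<le> (a k)\<^sup>2 + 2 * \<epsilon> k * a (Suc k)"
  shows "a n \<le> a 0 + 2 * (\<Sum>k. \<epsilon> k)"
proof -
  have inc: "a (Suc k) \<le> a k + 2 * \<epsilon> k" for k
  proof (rule ccontr)
    assume less: "\<not> ?thesis"
    then have "0 < a (Suc k)"
      using a[of k] \<epsilon>(1)[of k] by linarith
    have "2 * \<epsilon> k * a (Suc k) < (a (Suc k) - a k) * a (Suc k)"
      using less \<open>0 < a (Suc k)\<close> by (intro mult_strict_right_mono) auto
    also have "\<dots> \<le> (a (Suc k) - a k) * (a (Suc k) + a k)"
      using less a[of k] \<epsilon>(1)[of k] by (intro mult_left_mono) auto
    also have "\<dots> = (a (Suc k))\<^sup>2 - (a k)\<^sup>2"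
      by (simp add: power2_eq_square algebra_simps)
    finally show False
      using step[of k] by linarith
  qed
  have "a n \<le> a 0 + 2 * (\<Sum>k<n. \<epsilon> k)"
  proof (induction n)
    case (Suc n)
    then show ?case
      using inc[of n] by simp
  qed simp
  also have "\<dots> \<le> a 0 + 2 * (\<Sum>k. \<epsilon> k)"
    using sum_le_suminf[of \<epsilon> "{..<n}"] \<epsilon> by simp
  finally show ?thesis .
qed

section \<open>The ergodic estimate\<close>

theorem theorem3p11:
  fixes C :: "'a::{real_inner, complete_space} set"
    and F :: "'a \<Rightarrow> 'a"
    and \<nu> \<gamma> \<mu> L :: real
    and e1 e2 x y :: "nat \<Rightarrow> 'a"
    and \<beta> \<rho> \<Upsilon> :: "nat \<Rightarrow> real"
    and yavg :: "nat \<Rightarrow> 'a"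
    and M :: "'a \<Rightarrow> real"
    and t :: nat
  assumes "C \<noteq> {}" and "closed C" and "convex C"
    and "SOL C F \<noteq> {}"
    and "monotone_operator F"
    and "L > 0" and "L-lipschitz_on UNIV F"
    and "0 < \<nu>" and "\<nu> < 1"
    and "0 < \<gamma>" and "\<gamma> < 2"
    and "pc2_outer C F \<nu> \<gamma> e1 e2 \<beta> x y"
    and "summable (\<lambda>k. norm (e1 k))" and "summable (\<lambda>k. norm (e2 k))"
    and "0 \<le> \<mu>" and "\<mu> < 1 - \<nu>"
    and "\<And>k. norm (e1 k) \<le> \<mu> * norm (x k - y k)"
    and rho: "\<And>k. \<rho> k = pc_rho F (\<beta> k) (e1 k) (x k) (y k)"
    and Upsilon: "\<And>n. \<Upsilon> n = (\<Sum>k=0..n. \<rho> k * \<beta> k)"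
    and yavg: "\<And>n. yavg n = (1 / \<Upsilon> n) *\<^sub>R (\<Sum>k=0..n. (\<rho> k * \<beta> k) *\<^sub>R y k)"
    and M: "\<And>u. M u = (SUP k. norm (x (Suc k) - u)) * (\<Sum>k. norm (e2 k))"
    and "t > 0"
  shows "yavg t \<in> C \<and>
    (\<forall>u\<in>C. F u \<bullet> (yavg t - u) \<le> 1 / (2 * \<gamma> * \<Upsilon> t) * ((norm (u - x 0))\<^sup>2 + 2 * M u))"

proof -
  note C = assms(1-3) and mono = assms(5) and \<gamma> = assms(10,11) and e2 = assms(14)
  have b: "0 < \<beta> k" "\<beta> k * norm (F (x k) - F (y k)) \<le> \<nu> * norm (x k - y k)"
    and y: "y k = metric_proj C (x k - \<beta> k *\<^sub>R F (x k) + e1 k)"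
    and d: "pc_direction F (\<beta> k) (e1 k) (x k) (y k) \<noteq> 0"
    and x: "x (Suc k) = metric_proj C (x k - (\<gamma> * \<rho> k * \<beta> k) *\<^sub>R F (y k) + e2 k)" for k
    using assms(12)[unfolded pc2_outer_def, THEN spec, of k] unfolding rho by blast+
  have yC: "y k \<in> C" and xC: "x (Suc k) \<in> C" for k
    unfolding x y by (rule metric_proj_in[OF C])+
  have \<rho>_pos: "0 < \<rho> k" for k
    unfolding rho using b assms(16,17) d by (intro pc_rho_pos) auto
  then have w_pos: "0 < \<rho> k * \<beta> k" for k
    using b by simp
  have \<Upsilon>_pos: "0 < \<Upsilon> t"
    unfolding Upsilon by (intro sum_pos) (use w_pos in auto)

  have "(\<Sum>k=0..t. (\<rho> k * \<beta> k / \<Upsilon> t) *\<^sub>R y k) \<in> C"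
  proof (rule convex_sum)
    show "(\<Sum>k=0..t. \<rho> k * \<beta> k / \<Upsilon> t) = 1"
      using \<Upsilon>_pos by (simp add: sum_divide_distrib[symmetric] Upsilon[symmetric])
    show "0 \<le> \<rho> k * \<beta> k / \<Upsilon> t" for k
      using w_pos[of k] \<Upsilon>_pos by simp
  qed (use C yC in auto)
  then have avg: "yavg t \<in> C"
    by (simp add: yavg scaleR_sum_right)

  have step: "(norm (x (Suc k) - u))\<^sup>2 + 2 * \<gamma> * (\<rho> k * \<beta> k) * (F u \<bullet> (y k - u))
      \<le> (norm (x k - u))\<^sup>2 + 2 * norm (e2 k) * norm (x (Suc k) - u)" if "u \<in> C" for u k
  proof -
    have "(norm (x (Suc k) - u))\<^sup>2 + 2 * \<gamma> * (\<rho> k * \<beta> k) * (F (y k) \<bullet> (y k - u))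
        \<le> (norm (x k - u))\<^sup>2 + 2 * (e2 k \<bullet> (x (Suc k) - u))"
    proof (rule pc_step_estimate[OF pc_direction_def])
      show "(x k - \<beta> k *\<^sub>R F (x k) + e1 k - y k) \<bullet> (x (Suc k) - y k) \<le> 0"
        unfolding y by (rule metric_proj_dot[OF C xC])
      show "(x k - (\<gamma> * \<rho> k * \<beta> k) *\<^sub>R F (y k) + e2 k - x (Suc k)) \<bullet> (u - x (Suc k)) \<le> 0"
        unfolding x by (rule metric_proj_dot[OF C that])
      show "\<rho> k * (norm (pc_direction F (\<beta> k) (e1 k) (x k) (y k)))\<^sup>2
          = (x k - y k) \<bullet> pc_direction F (\<beta> k) (e1 k) (x k) (y k)"
        using d[of k] by (simp add: rho pc_rho_def)
    qed (use \<rho>_pos[of k] \<gamma> in auto)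
    moreover have "2 * \<gamma> * (\<rho> k * \<beta> k) * (F u \<bullet> (y k - u))
        \<le> 2 * \<gamma> * (\<rho> k * \<beta> k) * (F (y k) \<bullet> (y k - u))"
      using mono w_pos[of k] \<gamma>
      by (intro mult_left_mono) (auto simp: monotone_operator_def inner_diff_left)
    moreover have "e2 k \<bullet> (x (Suc k) - u) \<le> norm (e2 k) * norm (x (Suc k) - u)"
      by (rule norm_cauchy_schwarz)
    ultimately show ?thesis
      by linarith
  qed

  obtain s where s: "s \<in> C" "\<And>z. z \<in> C \<Longrightarrow> 0 \<le> F s \<bullet> (z - s)"
    using assms(4) by (auto simp: SOL_def)
  have bounded: "norm (x k - s) \<le> norm (x 0 - s) + 2 * (\<Sum>k. norm (e2 k))" for k
  proof (rule quasi_fejer_bounded)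
    show "(norm (x (Suc k) - s))\<^sup>2 \<le> (norm (x k - s))\<^sup>2 + 2 * norm (e2 k) * norm (x (Suc k) - s)" for k
    proof -
      have "0 \<le> 2 * \<gamma> * (\<rho> k * \<beta> k) * (F s \<bullet> (y k - s))"
        using s(2)[OF yC] w_pos[of k] \<gamma> by simp
      then show ?thesis
        using step[OF s(1), of k] by linarith
    qed
  qed (use e2 in auto)

  have "F u \<bullet> (yavg t - u) \<le> 1 / (2 * \<gamma> * \<Upsilon> t) * ((norm (u - x 0))\<^sup>2 + 2 * M u)" if u: "u \<in> C" for u
  proof -
    define S where "S = (SUP k. norm (x (Suc k) - u))"
    have "norm (x (Suc k) - u) \<le> norm (x 0 - s) + 2 * (\<Sum>k. norm (e2 k)) + norm (s - u)" for k
      using bounded[of "Suc k"] norm_triangle_ineq[of "x (Suc k) - s" "s - u"] by simp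
    then have "bdd_above (range (\<lambda>k. norm (x (Suc k) - u)))"
      by (intro bdd_aboveI2)
    then have S: "norm (x (Suc k) - u) \<le> S" for k
      unfolding S_def by (rule cSUP_upper[OF UNIV_I])
    then have "0 \<le> S"
      using norm_ge_zero order_trans by blast

    have "2 * \<gamma> * (\<rho> k * \<beta> k) * (F u \<bullet> (y k - u))
        \<le> (norm (x k - u))\<^sup>2 - (norm (x (Suc k) - u))\<^sup>2 + 2 * (S * norm (e2 k))" for k
      using step[OF u, of k] mult_left_mono[OF S[of k] norm_ge_zero[of "e2 k"]]
      unfolding mult.commute[of S] mult.assoc[of 2 "norm (e2 k)"] by linarith
    then have "(\<Sum>k=0..t. 2 * \<gamma> * (\<rho> k * \<beta> k) * (F u \<bullet> (y k - u)))
        \<le> (\<Sum>k=0..t. (norm (x k - u))\<^sup>2 - (norm (x (Suc k) - u))\<^sup>2 + 2 * (S * norm (e2 k)))"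
      by (rule sum_mono)
    also have "\<dots> = (\<Sum>k=0..t. (norm (x k - u))\<^sup>2 - (norm (x (Suc k) - u))\<^sup>2)
        + 2 * (S * (\<Sum>k=0..t. norm (e2 k)))"
      by (simp add: sum.distrib sum_distrib_left)
    also have "(\<Sum>k=0..t. (norm (x k - u))\<^sup>2 - (norm (x (Suc k) - u))\<^sup>2)
        = (norm (x 0 - u))\<^sup>2 - (norm (x (Suc t) - u))\<^sup>2"
      by (induction t) auto
    also have "S * (\<Sum>k=0..t. norm (e2 k)) \<le> M u"
      unfolding M S_def[symmetric] using \<open>0 \<le> S\<close> e2 by (intro mult_left_mono sum_le_suminf) auto
    finally have sum_le: "(\<Sum>k=0..t. 2 * \<gamma> * (\<rho> k * \<beta> k) * (F u \<bullet> (y k - u)))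
        \<le> (norm (u - x 0))\<^sup>2 + 2 * M u"
      using zero_le_power2[of "norm (x (Suc t) - u)"]
      unfolding norm_minus_commute[of u "x 0"] by linarith

    have "\<Upsilon> t *\<^sub>R (yavg t - u) = (\<Sum>k=0..t. (\<rho> k * \<beta> k) *\<^sub>R (y k - u))"
      using \<Upsilon>_pos
      by (simp add: yavg scaleR_diff_right sum_subtractf Upsilon[of t] scaleR_sum_left)
    then have "\<Upsilon> t * (F u \<bullet> (yavg t - u)) = (\<Sum>k=0..t. (\<rho> k * \<beta> k) * (F u \<bullet> (y k - u)))"
      by (metis (no_types, lifting) inner_scaleR_right inner_sum_right sum.cong)
    then have "2 * \<gamma> * \<Upsilon> t * (F u \<bullet> (yavg t - u))
        = (\<Sum>k=0..t. 2 * \<gamma> * (\<rho> k * \<beta> k) * (F u \<bullet> (y k - u)))"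
      by (simp add: mult.assoc sum_distrib_left)
    with sum_le show ?thesis
      using \<Upsilon>_pos \<gamma> by (simp add: field_simps)
  qed
  with avg show ?thesis
    by blast
qed

end
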